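(* Let $n\ge1$ and let $\alpha,\beta>0$. For every state $u$ of the TASEP with $n$ cells and parameters $\alpha,\beta$, the stationary probability of $u$ is $$\mathrm{prob}(u;\alpha,\beta)=\frac{1}{Z_n}\sum_{B}p(B),\qquad p(B)=\alpha^{-lb(B)}\,\beta^{-rb(B)},$$ where the sum is over all binary trees $B$ with $n+1$ vertices whose canopy is $u$ (the letter $a$ of the canopy corresponding to "occupied cell" and the letter $b$ to "empty cell"), $lb(B)$ (resp. $rb(B)$) is the number of vertices of the left branch (resp. right branch) of $B$ diminished by $1$, and $$Z_n=\sum_{B}p(B),$$ the sum being over all binary trees $B$ with $n+1$ vertices.
   Context: **TASEP (totally asymmetric exclusion process).** A one-dimensional strip of $n$ cells, each cell occupied by at most one particle. A state is the word $u=u_1\cdots u_n$ recording, from left to right, whether each cell is occupied or empty ($2^n$ states). The process is the continuous-time Markov chain with the following transitions: a particle in cell $i<n$ jumps to cell $i+1$ at rate $1$ if cell $i+1$ is empty; a particle enters cell $1$ at rate $\alpha$ if cell $1$ is empty; a particle in cell $n$ leaves the system at rate $\beta$. There is a unique stationary distribution, denoted $\mathrm{prob}(u;\alpha,\beta)$. **Binary trees.** A binary tree is either empty or a triple $(L,r,R)$ with root $r$ and left and right subtrees $L,R$, which are binary trees. The left (right) son of a vertex is the root of its left (right) subtree, if non-empty. The left (right) branch is the sequence of vertices obtained from the root by repeatedly passing to the left (right) son, starting with the root. The symmetric order (inorder) on vertices: first the left subtree, then the root, then the right subtree, recursively. **Canopy.** The canopy of a binary tree with $n+1$ vertices is the word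 $u_1\cdots u_n$ in the letters $a,b$ such that $u_i=a$ if the $i$-th vertex in symmetric order has a right son, and $u_i=b$ otherwise. *)

theory Defs
  imports "HOL-Probability.Probability" "HOL-Library.Tree"
begin

section \<open>Finite continuous-time Markov chains\<close>

text \<open>
  The chain has finite state set \<open>S\<close> and jumps from \<open>x\<close> to a different state \<open>y\<close> at rate
  \<open>r x y\<close>. A stationary distribution is a probability vector annihilated from the left by
  the infinitesimal generator (the Q-matrix).
\<close>

definition generator :: "'s set \<Rightarrow> ('s \<Rightarrow> 's \<Rightarrow> real) \<Rightarrow> 's \<Rightarrow> 's \<Rightarrow> real" where
  "generator S r x y = (if x = y then - (\<Sum>z\<in>S - {x}. r x z) else r x y)"

definition stationary :: "'s set \<Rightarrow> ('s \<Rightarrow> 's \<Rightarrow> real) \<Rightarrow> 's pmf \<Rightarrow> bool" where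
  "stationary S r \<mu> \<longleftrightarrow>
     set_pmf \<mu> \<subseteq> S \<and> (\<forall>y\<in>S. (\<Sum>x\<in>S. pmf \<mu> x * generator S r x y) = 0)"


section \<open>The TASEP\<close>

datatype cell = Occupied | Empty

definition tasep_states :: "nat \<Rightarrow> cell list set" where
  "tasep_states n = {u. length u = n}"

text \<open>
  Cells are indexed from \<open>0\<close>, so the \<open>i\<close>-th cell from the left is \<open>u ! (i - 1)\<close>. The three summands are
  the jumps inside the strip, the entrance at the left end and the exit at the right end; at
  most one of all these transitions leads from \<open>u\<close> to a given \<open>v\<close>.
\<close>

definition tasep_rate :: "nat \<Rightarrow> real \<Rightarrow> real \<Rightarrow> cell list \<Rightarrow> cell list \<Rightarrow> real" where
  "tasep_rate n \<alpha> \<beta> u v =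
     (\<Sum>i<n - 1. if u ! i = Occupied \<and> u ! Suc i = Empty \<and> v = u[i := Empty, Suc i := Occupied]
                then 1 else 0)
     + (if u ! 0 = Empty \<and> v = u[0 := Occupied] then \<alpha> else 0)
     + (if u ! (n - 1) = Occupied \<and> v = u[n - 1 := Empty] then \<beta> else 0)"

definition tasep_dist :: "nat \<Rightarrow> real \<Rightarrow> real \<Rightarrow> cell list pmf" where
  "tasep_dist n \<alpha> \<beta> = (THE \<mu>. stationary (tasep_states n) (tasep_rate n \<alpha> \<beta>) \<mu>)"

definition tasep_prob :: "nat \<Rightarrow> real \<Rightarrow> real \<Rightarrow> cell list \<Rightarrow> real" where
  "tasep_prob n \<alpha> \<beta> u = pmf (tasep_dist n \<alpha> \<beta>) u"


section \<open>Binary trees\<close>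

text \<open>
  Binary trees are unlabelled, i.e. of type \<^typ>\<open>unit tree\<close>, and \<^const>\<open>size\<close> counts their vertices.
  A vertex is represented by the subtree of which it is the root; \<open>vertex_tree t\<close> carries
  at each vertex this subtree, so that its inorder traversal lists the vertices of \<open>t\<close> in
  symmetric order, one entry for each vertex.
\<close>

definition binary_trees :: "nat \<Rightarrow> unit tree set" where
  "binary_trees m = {t. size t = m}"

primrec vertex_tree :: "'a tree \<Rightarrow> 'a tree tree" where
  "vertex_tree Leaf = Leaf"
| "vertex_tree (Node l x r) = Node (vertex_tree l) (Node l x r) (vertex_tree r)"

primrec has_right_son :: "'a tree \<Rightarrow> bool" where
  "has_right_son Leaf = False"
| "has_right_son (Node l x r) = (r \<noteq> Leaf)"

primrec left_branch :: "'a tree \<Rightarrow> 'a tree list" where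
  "left_branch Leaf = []"
| "left_branch (Node l x r) = Node l x r # left_branch l"

primrec right_branch :: "'a tree \<Rightarrow> 'a tree list" where
  "right_branch Leaf = []"
| "right_branch (Node l x r) = Node l x r # right_branch r"

definition lb :: "'a tree \<Rightarrow> nat" where
  "lb t = length (left_branch t) - 1"

definition rb :: "'a tree \<Rightarrow> nat" where
  "rb t = length (right_branch t) - 1"

datatype letter = La | Lb

text \<open>The last vertex in symmetric order contributes no letter.\<close>

definition canopy :: "'a tree \<Rightarrow> letter list" where
  "canopy t = butlast (map (\<lambda>v. if has_right_son v then La else Lb) (inorder (vertex_tree t)))"

primrec letter_of :: "cell \<Rightarrow> letter" where
  "letter_of Occupied = La"
| "letter_of Empty = Lb"

definition tree_weight :: "real \<Rightarrow> real \<Rightarrow> 'a tree \<Rightarrow> real" where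
  "tree_weight \<alpha> \<beta> t = \<alpha> powi (- int (lb t)) * \<beta> powi (- int (rb t))"

definition tree_Z :: "nat \<Rightarrow> real \<Rightarrow> real \<Rightarrow> real" where
  "tree_Z n \<alpha> \<beta> = (\<Sum>B\<in>binary_trees (n + 1). tree_weight \<alpha> \<beta> B)"

lemma finite_binary_trees: "finite (binary_trees m)"
proof (induction m rule: less_induct)
  case (less m)
  have "binary_trees m \<subseteq> {Leaf} \<union>
      (\<lambda>(l, r). Node l () r) ` ((\<Union>k<m. binary_trees k) \<times> (\<Union>k<m. binary_trees k))"
  proof
    fix t assume "t \<in> binary_trees m"
    then show "t \<in> {Leaf} \<union>
      (\<lambda>(l, r). Node l () r) ` ((\<Union>k<m. binary_trees k) \<times> (\<Union>k<m. binary_trees k))"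
      by (cases t) (auto simp: binary_trees_def image_iff)
  qed
  moreover have "finite (\<Union>k<m. binary_trees k)"
    using less by blast
  ultimately show ?case
    by (meson finite.emptyI finite.insertI finite_SigmaI finite_UnI finite_imageI finite_subset)
qed

end

theory Submission
  imports Defs
begin

text \<open>
  Write \<open>F u\<close> for the total weight of the trees with canopy \<open>u\<close> (\<open>canopy_weight\<close>), and \<open>D\<close>, \<open>E\<close> for
  an occupied and an empty cell. The function \<open>F\<close> satisfies the relations of the matrix ansatz of
  Derrida, Evans, Hakim and Pasquier:
  \<open>F (E w) = F w / \<alpha>\<close>, \<open>F (w D) = F w / \<beta>\<close> and \<open>F (u D E v) = F (u D v) + F (u E v)\<close>.

  All three come from one bijection. Read the canopy with the letter \<open>E\<close> of the last vertex
  restored and with a letter \<open>D\<close> put in front. A factor \<open>D E\<close> of this word marks a vertex without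
  sons: a vertex whose predecessor in symmetric order has a right son has no left son, and the letter
  \<open>E\<close> says that it has no right son. Removing it merges \<open>D E\<close> into a single letter, which is \<open>E\<close> or \<open>D\<close>
  according to whether the removed vertex was a right or a left son; conversely, a vertex can be
  grafted at any of the empty subtrees. The two branches keep their lengths, except that the left
  (right) branch loses a vertex when the removed vertex is the first (last) in symmetric order. These
  two exceptions are the relations with \<open>\<alpha>\<close> and \<open>\<beta>\<close>. See \<open>sum_graft\<close> and \<open>tree_weight_graft\<close>.

  The relations imply that \<open>F\<close> is annihilated by the generator. The net probability flow into a
  state \<open>y\<close> through the bond between the cells \<open>i\<close> and \<open>i + 1\<close> equals \<open>h i - h (i + 1)\<close>, where \<open>h i\<close>
  is \<open>\<plusminus>F\<close> of \<open>y\<close> with the cell \<open>i\<close> deleted, the sign depending on the letter in that cell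
  (\<open>bond_balance\<close>). The sum over the bonds telescopes, and the flows through the two ends of the
  strip cancel what remains.

  Finally, the stationary distribution is unique because every state can reach the empty strip
  (\<open>stationary_unique\<close>, \<open>exit_distance_decreases\<close>), so it is \<open>F\<close> divided by its sum \<open>Z\<^sub>n\<close>.
\<close>

section \<open>Uniqueness of stationary distributions\<close>

text \<open>
  The stationarity equations for arbitrary real functions: the uniqueness proof applies them to the
  difference of two distributions.
\<close>

definition invariant :: "'s set \<Rightarrow> ('s \<Rightarrow> 's \<Rightarrow> real) \<Rightarrow> ('s \<Rightarrow> real) \<Rightarrow> bool" where
  "invariant S r f \<longleftrightarrow> (\<forall>y\<in>S. (\<Sum>x\<in>S. f x * generator S r x y) = 0)"

lemma generator_row_sum:
  assumes "finite S" "x \<in> S"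
  shows "(\<Sum>y\<in>S. generator S r x y) = 0"
proof -
  have "(\<Sum>y\<in>S. generator S r x y) = generator S r x x + (\<Sum>y\<in>S - {x}. generator S r x y)"
    using assms by (simp add: sum.remove)
  also have "(\<Sum>y\<in>S - {x}. generator S r x y) = (\<Sum>y\<in>S - {x}. r x y)"
    by (rule sum.cong) (auto simp: generator_def)
  finally show ?thesis by (simp add: generator_def)
qed

lemma generator_column:
  assumes "finite S" "y \<in> S"
  shows "(\<Sum>x\<in>S. f x * generator S r x y) =
    (\<Sum>x\<in>S - {y}. f x * r x y) - f y * (\<Sum>z\<in>S - {y}. r y z)"
proof -
  have "(\<Sum>x\<in>S. f x * generator S r x y) =
      f y * generator S r y y + (\<Sum>x\<in>S - {y}. f x * generator S r x y)"
    using assms by (simp add: sum.remove)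
  also have "(\<Sum>x\<in>S - {y}. f x * generator S r x y) = (\<Sum>x\<in>S - {y}. f x * r x y)"
    by (rule sum.cong) (auto simp: generator_def)
  finally show ?thesis by (simp add: generator_def)
qed

text \<open>
  By the triangle inequality, \<open>\<bar>d\<bar>\<close> multiplied by the generator is nonnegative in every coordinate.
  The rows of the generator have sum 0, so these coordinates add up to 0 and all of them vanish.
\<close>

lemma invariant_abs:
  assumes "finite S" and r: "\<And>x y. r x y \<ge> 0" and d: "invariant S r d"
  shows "invariant S r (\<lambda>x. \<bar>d x\<bar>)"
proof -
  define g where "g y = (\<Sum>x\<in>S. \<bar>d x\<bar> * generator S r x y)" for y
  have g_nonneg: "g y \<ge> 0" if y: "y \<in> S" for y
  proof -
    have out: "(\<Sum>z\<in>S - {y}. r y z) \<ge> 0"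
      by (intro sum_nonneg r)
    have "\<bar>d y\<bar> * (\<Sum>z\<in>S - {y}. r y z) = \<bar>d y * (\<Sum>z\<in>S - {y}. r y z)\<bar>"
      using out by (simp add: abs_mult)
    also have "d y * (\<Sum>z\<in>S - {y}. r y z) = (\<Sum>x\<in>S - {y}. d x * r x y)"
      using d y generator_column[OF \<open>finite S\<close> y, of d r] by (simp add: invariant_def)
    also have "\<bar>\<dots>\<bar> \<le> (\<Sum>x\<in>S - {y}. \<bar>d x * r x y\<bar>)"
      by (rule sum_abs)
    also have "\<dots> = (\<Sum>x\<in>S - {y}. \<bar>d x\<bar> * r x y)"
      by (simp add: abs_mult r)
    finally show ?thesis
      unfolding g_def by (simp add: generator_column[OF \<open>finite S\<close> y])
  qed
  have "(\<Sum>y\<in>S. g y) = (\<Sum>x\<in>S. \<bar>d x\<bar> * (\<Sum>y\<in>S. generator S r x y))"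
    unfolding g_def by (subst sum.swap) (simp add: sum_distrib_left)
  also have "\<dots> = 0"
    by (rule sum.neutral) (simp add: generator_row_sum \<open>finite S\<close>)
  finally have "\<forall>y\<in>S. g y = 0"
    using sum_nonneg_eq_0_iff[OF \<open>finite S\<close>, of g] g_nonneg by blast
  then show ?thesis by (simp add: invariant_def g_def)
qed

text \<open>
  In equilibrium nothing flows into a state of mass 0, so a zero of \<open>f\<close> spreads backwards along the
  transitions. The rank makes this induction reach every state from \<open>z\<close>.
\<close>

lemma invariant_eq_0_if_sink_eq_0:
  fixes rank :: "'s \<Rightarrow> nat"
  assumes "finite S" and r: "\<And>x y. r x y \<ge> 0"
    and f: "invariant S r f" "\<And>x. x \<in> S \<Longrightarrow> f x \<ge> 0" and z: "f z = 0"
    and step: "\<And>x. x \<in> S \<Longrightarrow> x \<noteq> z \<Longrightarrow> \<exists>y\<in>S. rank y < rank x \<and> r x y > 0"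
    and "x \<in> S"
  shows "f x = 0"
  using \<open>x \<in> S\<close>
proof (induction "rank x" arbitrary: x rule: less_induct)
  case less
  show ?case
  proof (cases "x = z")
    case False
    then obtain y where y: "y \<in> S" "rank y < rank x" "r x y > 0"
      using step less.prems by blast
    then have "f y = 0" using less.hyps by blast
    then have "(\<Sum>x\<in>S - {y}. f x * r x y) = 0"
      using f(1) y(1) generator_column[OF \<open>finite S\<close> y(1), of f r] by (simp add: invariant_def)
    moreover have "\<And>x. x \<in> S - {y} \<Longrightarrow> f x * r x y \<ge> 0"
      using f(2) r by simp
    ultimately have "\<forall>x\<in>S - {y}. f x * r x y = 0"
      using sum_nonneg_eq_0_iff[of "S - {y}" "\<lambda>x. f x * r x y"] \<open>finite S\<close> by blast
    moreover have "x \<in> S - {y}" using less.prems y(2) by auto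
    ultimately show ?thesis using y(3) by auto
  qed (simp add: z)
qed

text \<open>
  If \<open>d\<close> is the difference of two stationary distributions, ordered so that \<open>d z \<le> 0\<close>, then
  \<open>\<bar>d\<bar> + d\<close> is invariant, nonnegative and zero at \<open>z\<close>. Hence it is zero everywhere, which means
  \<open>d \<le> 0\<close>, and \<open>d\<close> has sum 0.
\<close>

lemma stationary_unique:
  fixes rank :: "'s \<Rightarrow> nat"
  assumes "finite S" and r: "\<And>x y. r x y \<ge> 0"
    and step: "\<And>x. x \<in> S \<Longrightarrow> x \<noteq> z \<Longrightarrow> \<exists>y\<in>S. rank y < rank x \<and> r x y > 0"
    and st: "stationary S r \<mu>" "stationary S r \<nu>"
  shows "\<mu> = \<nu>"
proof -
  have le: "pmf p x \<le> pmf q x"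
    if st: "stationary S r p" "stationary S r q" and z: "pmf p z \<le> pmf q z" and "x \<in> S" for p q x
  proof -
    define d where "d x = pmf p x - pmf q x" for x
    define e where "e x = \<bar>d x\<bar> + d x" for x
    have d: "invariant S r d"
      using st by (simp add: invariant_def stationary_def d_def left_diff_distrib sum_subtractf)
    from invariant_abs[OF \<open>finite S\<close> r d] d have "invariant S r e"
      by (simp add: invariant_def e_def distrib_right sum.distrib)
    moreover have "e z = 0" using z by (simp add: e_def d_def)
    moreover have "e x \<ge> 0" for x by (simp add: e_def)
    ultimately have "e x = 0"
      using invariant_eq_0_if_sink_eq_0[where f = e, OF \<open>finite S\<close> r _ _ _ step \<open>x \<in> S\<close>] by blast
    then show ?thesis by (simp add: e_def d_def)
  qed
  have eq: "p = q"
    if st: "stationary S r p" "stationary S r q" and z: "pmf p z \<le> pmf q z" for p q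
  proof (rule pmf_eqI)
    fix x
    have sums: "sum (pmf p) S = 1" "sum (pmf q) S = 1"
      using st \<open>finite S\<close> by (auto simp: stationary_def intro!: sum_pmf_eq_1)
    have "(\<Sum>x\<in>S. pmf q x - pmf p x) = 0"
      by (simp add: sum_subtractf sums)
    then have "\<forall>x\<in>S. pmf q x - pmf p x = 0"
      using sum_nonneg_eq_0_iff[OF \<open>finite S\<close>, of "\<lambda>x. pmf q x - pmf p x"] le[OF st z] by simp
    moreover have "pmf p x = 0" "pmf q x = 0" if "x \<notin> S"
      using st that by (auto simp: stationary_def pmf_eq_0_set_pmf)
    ultimately show "pmf p x = pmf q x" by fastforce
  qed
  show ?thesis
    using eq[OF st] eq[OF st(2,1)] by (metis linear)
qed


section \<open>Grafting a vertex onto a tree\<close>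

text \<open>
  The canopy written in cells, including the letter of the last vertex. Unlike the canopy itself,
  this word is described by a recursion on the tree.
\<close>

definition occ :: "'a tree \<Rightarrow> cell list" where
  "occ t = map (\<lambda>v. if has_right_son v then Occupied else Empty) (inorder (vertex_tree t))"

lemma occ_simps [simp]:
  "occ Leaf = []"
  "occ (Node l x r) = occ l @ (if r = Leaf then Empty else Occupied) # occ r"
  by (simp_all add: occ_def)

lemma length_occ [simp]: "length (occ t) = size t"
  by (induction t) auto

lemma size_eq_if_occ_eq: "occ t = w \<Longrightarrow> size t = length w"
  using length_occ[of t] by simp

lemma occ_eq_Nil_iff [simp]: "occ t = [] \<longleftrightarrow> t = Leaf"
  by (cases t) auto

lemma last_occ: "t \<noteq> Leaf \<Longrightarrow> last (occ t) = Empty"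
  by (induction t) auto

lemma map_letter_of_eq_iff: "map letter_of u = map letter_of v \<longleftrightarrow> u = v"
proof -
  have "inj letter_of"
  proof (rule injI)
    fix x y :: cell assume "letter_of x = letter_of y"
    then show "x = y" by (cases x; cases y) auto
  qed
  then show ?thesis by (simp add: inj_map_eq_map)
qed

lemma canopy_occ: "canopy t = map letter_of (butlast (occ t))"
  by (simp add: canopy_def occ_def map_butlast o_def if_distrib cong: if_cong)

lemma canopy_eq_iff:
  "size t = length u + 1 \<and> canopy t = map letter_of u \<longleftrightarrow> occ t = u @ [Empty]"
proof
  assume *: "size t = length u + 1 \<and> canopy t = map letter_of u"
  then have "butlast (occ t) = u" by (simp add: canopy_occ map_letter_of_eq_iff)
  moreover have "t \<noteq> Leaf" using * by auto
  ultimately show "occ t = u @ [Empty]"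
    using append_butlast_last_id[of "occ t"] by (simp add: last_occ)
next
  assume *: "occ t = u @ [Empty]"
  show "size t = length u + 1 \<and> canopy t = map letter_of u"
    using * size_eq_if_occ_eq[OF *] by (simp add: canopy_occ)
qed

text \<open>
  Put a new vertex in place of the \<open>k\<close>-th empty subtree, counted from 0 from left to right. A tree with \<open>m\<close>
  vertices has the empty subtrees \<open>0, \<dots>, m\<close>, and the new vertex has exactly \<open>k\<close> vertices before it in
  symmetric order.
\<close>

primrec graft :: "nat \<Rightarrow> unit tree \<Rightarrow> unit tree" where
  "graft k Leaf = Node Leaf () Leaf"
| "graft k (Node l x r) =
     (if k \<le> size l then Node (graft k l) x r else Node l x (graft (k - Suc (size l)) r))"

lemma size_graft [simp]: "size (graft k t) = Suc (size t)"
  by (induction t arbitrary: k) auto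

lemma graft_neq_Leaf [simp]: "graft k t \<noteq> Leaf"
  by (cases t) auto

text \<open>
  The letter \<open>Occupied\<close> in front stands for a fictitious vertex preceding all others, so that
  grafting at the far left needs no separate treatment. In this word, position \<open>k\<close> is the letter of the
  predecessor of the new vertex. If the new vertex becomes its right son, the letter changes from
  \<open>Empty\<close> to \<open>Occupied\<close>; if it becomes the left son of its successor, the letter was \<open>Occupied\<close>
  already. In both cases the letter is replaced by \<open>Occupied\<close>, \<open>Empty\<close>.
\<close>

lemma occ_graft:
  assumes "k \<le> size t"
  shows "Occupied # occ (graft k t) =
    take k (Occupied # occ t) @ Occupied # Empty # drop (Suc k) (Occupied # occ t)"
  using assms
proof (induction t arbitrary: k)
  case (Node l x r)
  show ?case
  proof (cases "k \<le> size l")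
    case True
    have "Occupied # occ (graft k (Node l x r)) =
        (Occupied # occ (graft k l)) @ (if r = Leaf then Empty else Occupied) # occ r"
      using True by simp
    also note Node.IH(1)[OF True]
    finally show ?thesis using True by (cases k) auto
  next
    case False
    define j where "j = k - Suc (size l)"
    have k: "k = Suc (size l + j)" using False by (simp add: j_def)
    have j: "j \<le> size r" using Node.prems k by simp
    have "Occupied # occ (graft k (Node l x r)) = (Occupied # occ l) @ (Occupied # occ (graft j r))"
      using False by (simp add: j_def)
    also note Node.IH(2)[OF j]
    also have "take j (Occupied # occ r) = take j ((if r = Leaf then Empty else Occupied) # occ r)"
      using j by (cases j) auto
    finally show ?thesis by (simp add: k)
  qed
qed simp

lemma graft_inject:
  assumes "k \<le> size s" "k \<le> size t" "graft k s = graft k t"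
  shows "s = t"
  using assms
proof (induction s arbitrary: t k)
  case Leaf
  then show ?case by (cases t) (auto split: if_splits dest: sym)
next
  case (Node l x r)
  have "size t = size (Node l x r)"
    using arg_cong[OF Node.prems(3), of size] by (simp only: size_graft)
  then have "t \<noteq> Leaf" by auto
  then obtain l' x' r' where t: "t = Node l' x' r'" by (cases t) auto
  show ?case
  proof (cases "k \<le> size l"; cases "k \<le> size l'")
    assume "k \<le> size l" "k \<le> size l'"
    then show ?thesis using Node t by auto
  next
    assume *: "k \<le> size l" "\<not> k \<le> size l'"
    then have "graft k l = l'" using Node.prems t by simp
    then have "size l' = Suc (size l)" by auto
    then show ?thesis using * by simp
  next
    assume *: "\<not> k \<le> size l" "k \<le> size l'"
    then have "graft k l' = l" using Node.prems t by simp
    then have "size l = Suc (size l')" by auto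
    then show ?thesis using * by simp
  next
    assume *: "\<not> k \<le> size l" "\<not> k \<le> size l'"
    then have l: "l = l'" and eq: "graft (k - Suc (size l)) r = graft (k - Suc (size l)) r'"
      using Node.prems t by auto
    have "k - Suc (size l) \<le> size r" "k - Suc (size l) \<le> size r'"
      using Node.prems(1,2) l by (simp_all add: t)
    then have "r = r'" using eq by (rule Node.IH(2))
    then show ?thesis by (simp add: t l)
  qed
qed

text \<open>
  The induction compares the position of the factor \<open>Occupied\<close>, \<open>Empty\<close> with that of the root. The
  factor cannot end at the root unless the tree is a single vertex, because a nonempty left subtree
  contributes \<open>Empty\<close> as its last letter. When the factor begins at the root or later, the letter of the
  root plays the part of the \<open>Occupied\<close> in front of the right subtree.
\<close>

lemma graft_surj:
  assumes "Occupied # occ t = u @ Occupied # Empty # v"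
  shows "\<exists>s. t = graft (length u) s \<and> length u \<le> size s"
  using assms
proof (induction t arbitrary: u v)
  case (Node l x r)
  define d where "d = (if r = Leaf then Empty else Occupied)"
  have eq: "(Occupied # occ l) @ d # occ r = u @ Occupied # Empty # v"
    using Node.prems by (simp add: d_def)
  have len: "size l + size r = length u + length v"
    using arg_cong[OF eq, of length] by simp
  consider "length u < size l" | "length u = size l" | "length u > size l" by linarith
  then show ?case
  proof cases
    case 1
    have "Occupied # occ l = take (Suc (size l)) (u @ Occupied # Empty # v)"
      unfolding eq[symmetric] by simp
    also have "\<dots> = u @ Occupied # Empty # take (size l - Suc (length u)) v"
      using 1 by (simp add: take_Cons' Suc_diff_le)
    finally obtain s where "l = graft (length u) s" "length u \<le> size s"
      using Node.IH(1) by blast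
    then have "Node l x r = graft (length u) (Node s x r)" "length u \<le> size (Node s x r)" by auto
    then show ?thesis by blast
  next
    case 2
    have "Occupied # occ l = take (Suc (size l)) (u @ Occupied # Empty # v)"
      unfolding eq[symmetric] by simp
    also have "\<dots> = u @ [Occupied]" using 2 by simp
    finally have "last (Occupied # occ l) = Occupied" by simp
    then have l: "l = Leaf" using last_occ[of l] by (auto split: if_splits)
    then have "d = Empty" using eq 2 by simp
    then have "r = Leaf" by (auto simp: d_def split: if_splits)
    then have "Node l x r = graft (length u) Leaf" "length u \<le> size (Leaf :: unit tree)"
      using 2 l by auto
    then show ?thesis by blast
  next
    case 3
    define w where "w = drop (Suc (size l)) u"
    have "drop (Suc (size l)) ((Occupied # occ l) @ d # occ r) = d # occ r" by simp
    then have dr: "d # occ r = w @ Occupied # Empty # v"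
      unfolding eq w_def using 3 by simp
    then have "r \<noteq> Leaf" by (auto dest: arg_cong[where f = length])
    then have "Occupied # occ r = w @ Occupied # Empty # v"
      using dr by (simp add: d_def)
    then obtain s where s: "r = graft (length w) s" "length w \<le> size s"
      using Node.IH(2) by blast
    have "length u = Suc (size l) + length w" using 3 by (simp add: w_def)
    then have "Node l x r = graft (length u) (Node l x s)" "length u \<le> size (Node l x s)"
      using s by auto
    then show ?thesis by blast
  qed
qed simp

lemma finite_occ: "finite {t :: unit tree. Occupied # occ t = w}"
proof (rule finite_subset)
  show "{t. Occupied # occ t = w} \<subseteq> binary_trees (length w - 1)"
    by (auto simp: binary_trees_def)
qed (rule finite_binary_trees)

text \<open>
  The bijection between trees with a factor \<open>Occupied\<close>, \<open>Empty\<close> at a given position and trees with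
  one vertex less, in summed form. The three relations for canopy weights are instances of it.
\<close>

lemma sum_graft:
  fixes p :: "unit tree \<Rightarrow> real"
  shows "(\<Sum>t | Occupied # occ t = u @ Occupied # Empty # v. p t) =
    (\<Sum>s | Occupied # occ s = u @ Occupied # v. p (graft (length u) s)) +
    (\<Sum>s | Occupied # occ s = u @ Empty # v. p (graft (length u) s))"
proof -
  define A where "A c = {s :: unit tree. Occupied # occ s = u @ c # v}" for c
  have size: "length u \<le> size s" if "s \<in> A c" for s c
  proof -
    have "Occupied # occ s = u @ c # v" using that by (simp add: A_def)
    from arg_cong[OF this, of length] show ?thesis by simp
  qed
  have "inj_on (graft (length u)) (A Occupied \<union> A Empty)"
    by (rule inj_onI) (metis Un_iff graft_inject size)
  moreover have "{t. Occupied # occ t = u @ Occupied # Empty # v} =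
      graft (length u) ` (A Occupied \<union> A Empty)" (is "?L = ?R")
  proof
    show "?L \<subseteq> ?R"
    proof
      fix t assume t: "t \<in> ?L"
      then obtain s where s: "t = graft (length u) s" "length u \<le> size s"
        using graft_surj by blast
      define w where "w = Occupied # occ s"
      have w: "length u < length w" using s by (simp add: w_def)
      have "take (length u) w @ Occupied # Empty # drop (Suc (length u)) w =
          u @ Occupied # Empty # v"
        using occ_graft[OF s(2)] t s(1) by (simp add: w_def)
      moreover have "length (take (length u) w) = length u" using w by simp
      ultimately have "take (length u) w = u" "drop (Suc (length u)) w = v"
        by (metis append_eq_append_conv list.inject)+
      then have "w = u @ w ! length u # v"
        using id_take_nth_drop[OF w] by simp
      then have "s \<in> A (w ! length u)" by (simp add: A_def w_def)
      then have "s \<in> A Occupied \<union> A Empty" by (cases "w ! length u") auto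
      then show "t \<in> ?R" using s by blast
    qed
  next
    show "?R \<subseteq> ?L"
    proof
      fix t assume "t \<in> ?R"
      then obtain s c where s: "t = graft (length u) s" "s \<in> A c" by blast
      then show "t \<in> ?L"
        using occ_graft[OF size[OF s(2)]] by (simp add: A_def)
    qed
  qed
  ultimately have "(\<Sum>t | Occupied # occ t = u @ Occupied # Empty # v. p t) =
      (\<Sum>s\<in>A Occupied \<union> A Empty. p (graft (length u) s))"
    by (simp add: sum.reindex)
  also have "\<dots> = (\<Sum>s\<in>A Occupied. p (graft (length u) s)) + (\<Sum>s\<in>A Empty. p (graft (length u) s))"
    by (rule sum.union_disjoint) (auto simp: A_def intro: finite_occ)
  finally show ?thesis by (simp add: A_def)
qed

lemma left_branch_graft:
  "k \<le> size t \<Longrightarrow> length (left_branch (graft k t)) =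
    length (left_branch t) + (if k = 0 then 1 else 0)"
  by (induction t arbitrary: k) auto

lemma right_branch_graft:
  "k \<le> size t \<Longrightarrow> length (right_branch (graft k t)) =
    length (right_branch t) + (if k = size t then 1 else 0)"
  by (induction t arbitrary: k) auto

lemma tree_weight_alt: "tree_weight \<alpha> \<beta> t = (1 / \<alpha>) ^ lb t * (1 / \<beta>) ^ rb t"
  by (simp add: tree_weight_def power_int_minus power_one_over inverse_eq_divide)

lemma tree_weight_graft:
  assumes "k \<le> size t" "t \<noteq> Leaf"
  shows "tree_weight \<alpha> \<beta> (graft k t) = tree_weight \<alpha> \<beta> t *
    (if k = 0 then 1 / \<alpha> else 1) * (if k = size t then 1 / \<beta> else 1)"
proof -
  have "left_branch t \<noteq> []" "right_branch t \<noteq> []" using assms(2) by (cases t; simp)+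
  then have "length (left_branch t) \<ge> 1" "length (right_branch t) \<ge> 1"
    by (simp_all add: Suc_le_eq)
  then have "lb (graft k t) = lb t + (if k = 0 then 1 else 0)"
    "rb (graft k t) = rb t + (if k = size t then 1 else 0)"
    by (simp_all add: lb_def rb_def left_branch_graft right_branch_graft assms(1))
  then show ?thesis by (simp add: tree_weight_alt)
qed

lemma tree_weight_pos: "\<alpha> > 0 \<Longrightarrow> \<beta> > 0 \<Longrightarrow> tree_weight \<alpha> \<beta> t > 0"
  by (simp add: tree_weight_alt)


section \<open>The matrix ansatz relations\<close>

definition canopy_weight :: "real \<Rightarrow> real \<Rightarrow> cell list \<Rightarrow> real" where
  "canopy_weight \<alpha> \<beta> u = (\<Sum>t | occ t = u @ [Empty]. tree_weight \<alpha> \<beta> (t :: unit tree))"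

text \<open>
  Here the factor \<open>Occupied\<close>, \<open>Empty\<close> begins with the fictitious letter. As this letter is
  \<open>Occupied\<close> for every tree, the second of the two sums is empty.
\<close>

lemma canopy_weight_Empty_Cons:
  "canopy_weight \<alpha> \<beta> (Empty # w) = canopy_weight \<alpha> \<beta> w / \<alpha>"
proof -
  have "canopy_weight \<alpha> \<beta> (Empty # w) =
      (\<Sum>s :: unit tree | occ s = w @ [Empty]. tree_weight \<alpha> \<beta> (graft 0 s))"
    using sum_graft[where u = "[]" and v = "w @ [Empty]" and p = "tree_weight \<alpha> \<beta>"] by (simp add: canopy_weight_def)
  also have "\<dots> = (\<Sum>s :: unit tree | occ s = w @ [Empty]. tree_weight \<alpha> \<beta> s / \<alpha>)"
  proof (rule sum.cong)
    fix s :: "unit tree" assume "s \<in> {s. occ s = w @ [Empty]}"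
    then have "s \<noteq> Leaf" by auto
    then show "tree_weight \<alpha> \<beta> (graft 0 s) = tree_weight \<alpha> \<beta> s / \<alpha>"
      by (simp add: tree_weight_graft)
  qed simp
  finally show ?thesis by (simp add: canopy_weight_def sum_divide_distrib)
qed

text \<open>
  The factor is now formed with the letter \<open>Empty\<close> of the last vertex. The sum over words ending in
  \<open>Occupied\<close> is empty, since the last vertex never has a right son.
\<close>

lemma canopy_weight_snoc_Occupied:
  "canopy_weight \<alpha> \<beta> (w @ [Occupied]) = canopy_weight \<alpha> \<beta> w / \<beta>"
proof -
  have no_trees: "{s :: unit tree. occ s = w @ [Occupied]} = {}"
  proof -
    have False if "occ s = w @ [Occupied]" for s :: "unit tree"
      using that last_occ[of s] by (cases "s = Leaf") auto
    then show ?thesis by blast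
  qed
  have "canopy_weight \<alpha> \<beta> (w @ [Occupied]) =
      (\<Sum>s :: unit tree | occ s = w @ [Empty]. tree_weight \<alpha> \<beta> (graft (Suc (length w)) s))"
    using sum_graft[where u = "Occupied # w" and v = "[]" and p = "tree_weight \<alpha> \<beta>"] no_trees
    by (simp add: canopy_weight_def)
  also have "\<dots> = (\<Sum>s :: unit tree | occ s = w @ [Empty]. tree_weight \<alpha> \<beta> s / \<beta>)"
  proof (rule sum.cong)
    fix s :: "unit tree" assume s: "s \<in> {s. occ s = w @ [Empty]}"
    then have "size s = Suc (length w)" using size_eq_if_occ_eq[of s] by simp
    moreover from this have "s \<noteq> Leaf" by auto
    ultimately show "tree_weight \<alpha> \<beta> (graft (Suc (length w)) s) = tree_weight \<alpha> \<beta> s / \<beta>"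
      by (simp add: tree_weight_graft)
  qed simp
  finally show ?thesis by (simp add: canopy_weight_def sum_divide_distrib)
qed

lemma canopy_weight_Occupied_Empty:
  "canopy_weight \<alpha> \<beta> (u @ Occupied # Empty # v) =
    canopy_weight \<alpha> \<beta> (u @ Occupied # v) + canopy_weight \<alpha> \<beta> (u @ Empty # v)"
proof -
  have unchanged: "(\<Sum>s :: unit tree | occ s = u @ c # v @ [Empty].
        tree_weight \<alpha> \<beta> (graft (Suc (length u)) s)) = canopy_weight \<alpha> \<beta> (u @ c # v)" for c
    unfolding canopy_weight_def
  proof (rule sum.cong)
    fix s :: "unit tree" assume "s \<in> {s. occ s = (u @ c # v) @ [Empty]}"
    then have "size s = length u + length v + 2" using size_eq_if_occ_eq[of s] by simp
    moreover from this have "s \<noteq> Leaf" by auto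
    ultimately show "tree_weight \<alpha> \<beta> (graft (Suc (length u)) s) = tree_weight \<alpha> \<beta> s"
      by (simp add: tree_weight_graft)
  qed simp
  show ?thesis
    using sum_graft[where u = "Occupied # u" and v = "v @ [Empty]" and p = "tree_weight \<alpha> \<beta>"]
    by (simp add: unchanged canopy_weight_def[of _ _ "u @ Occupied # Empty # v"])
qed


section \<open>Balance\<close>

definition delete_nth :: "nat \<Rightarrow> 'a list \<Rightarrow> 'a list" where
  "delete_nth i u = take i u @ drop (Suc i) u"

text \<open>
  This sign makes the flow through the bonds telescope. By the third relation, the net flow through a
  bond between different cells is, up to a sign, the sum of the weights of the two words with one of
  these cells deleted. The sign is that of the left cell and opposite to that of the right cell.
\<close>

definition hole_sign :: "cell \<Rightarrow> real" where
  "hole_sign c = (case c of Occupied \<Rightarrow> - 1 | Empty \<Rightarrow> 1)"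

lemma hole_sign_simps [simp]: "hole_sign Occupied = - 1" "hole_sign Empty = 1"
  by (simp_all add: hole_sign_def)

text \<open>
  If the two cells are equal, no particle crosses the bond and deleting either cell gives the same
  word. Otherwise the claim is the relation for \<open>Occupied\<close>, \<open>Empty\<close>, read as inflow or as
  outflow.
\<close>

lemma bond_balance:
  assumes "Suc i < length y"
  shows "(if y ! i = Empty \<and> y ! Suc i = Occupied
            then canopy_weight \<alpha> \<beta> (y[i := Occupied, Suc i := Empty]) else 0)
       - (if y ! i = Occupied \<and> y ! Suc i = Empty then canopy_weight \<alpha> \<beta> y else 0)
    = hole_sign (y ! i) * canopy_weight \<alpha> \<beta> (delete_nth i y)
      - hole_sign (y ! Suc i) * canopy_weight \<alpha> \<beta> (delete_nth (Suc i) y)"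
proof -
  define u v where "u = take i y" and "v = drop (Suc (Suc i)) y"
  obtain c d where cd: "y ! i = c" "y ! Suc i = d" by blast
  have y: "y = u @ c # d # v"
    using assms cd id_take_nth_drop[of i y] Cons_nth_drop_Suc[of "Suc i" y]
    by (simp add: u_def v_def)
  have i: "i = length u" using assms by (simp add: u_def)
  have "delete_nth i y = u @ d # v" "delete_nth (Suc i) y = u @ c # v"
    by (simp_all add: delete_nth_def i y)
  moreover have "y[i := Occupied, Suc i := Empty] = u @ Occupied # Empty # v"
    by (simp add: i y list_update_append)
  ultimately show ?thesis
    unfolding cd by (cases c; cases d) (auto simp: y canopy_weight_Occupied_Empty)
qed

lemma left_balance:
  assumes "y \<noteq> []" "\<alpha> > 0"
  shows "(if y ! 0 = Occupied then canopy_weight \<alpha> \<beta> (y[0 := Empty]) * \<alpha> else 0)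
       - (if y ! 0 = Empty then canopy_weight \<alpha> \<beta> y * \<alpha> else 0)
    = - hole_sign (y ! 0) * canopy_weight \<alpha> \<beta> (delete_nth 0 y)"
proof -
  obtain c w where y: "y = c # w" using assms by (cases y) auto
  show ?thesis
    using assms(2) by (cases c) (simp_all add: y delete_nth_def canopy_weight_Empty_Cons)
qed

lemma right_balance:
  assumes "y \<noteq> []" "\<beta> > 0"
  shows "(if y ! (length y - 1) = Empty
            then canopy_weight \<alpha> \<beta> (y[length y - 1 := Occupied]) * \<beta> else 0)
       - (if y ! (length y - 1) = Occupied then canopy_weight \<alpha> \<beta> y * \<beta> else 0)
    = hole_sign (y ! (length y - 1)) * canopy_weight \<alpha> \<beta> (delete_nth (length y - 1) y)"
proof -
  obtain c w where y: "y = w @ [c]" using assms by (cases y rule: rev_cases) auto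
  show ?thesis
    using assms(2)
    by (cases c) (simp_all add: y delete_nth_def canopy_weight_snoc_Occupied list_update_append)
qed

lemma finite_tasep_states: "finite (tasep_states n)"
proof -
  have "(UNIV :: cell set) = {Occupied, Empty}" by (auto intro: cell.exhaust)
  then have "finite (UNIV :: cell set)" by (metis finite.emptyI finite.insertI)
  then show ?thesis
    using finite_lists_length_eq[of "UNIV :: cell set" n] by (simp add: tasep_states_def)
qed

lemma tasep_rate_nonneg: "\<alpha> > 0 \<Longrightarrow> \<beta> > 0 \<Longrightarrow> tasep_rate n \<alpha> \<beta> u v \<ge> 0"
  unfolding tasep_rate_def by (intro add_nonneg_nonneg sum_nonneg) auto

lemma tasep_rate_self:
  assumes "n \<ge> 1" "u \<in> tasep_states n"
  shows "tasep_rate n \<alpha> \<beta> u u = 0"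
proof -
  have len: "length u = n" using assms by (simp add: tasep_states_def)
  have "u \<noteq> u[i := Empty, Suc i := Occupied]" if "u ! i = Occupied" "i < n - 1" for i
  proof
    assume "u = u[i := Empty, Suc i := Occupied]"
    then have "u ! i = u[i := Empty, Suc i := Occupied] ! i" by simp
    then show False using that len by simp
  qed
  moreover have "u \<noteq> u[0 := Occupied]" if "u ! 0 = Empty"
  proof
    assume "u = u[0 := Occupied]"
    then have "u ! 0 = u[0 := Occupied] ! 0" by simp
    then show False using that len assms by simp
  qed
  moreover have "u \<noteq> u[n - 1 := Empty]" if "u ! (n - 1) = Occupied"
  proof
    assume "u = u[n - 1 := Empty]"
    then have "u ! (n - 1) = u[n - 1 := Empty] ! (n - 1)" by simp
    then show False using that len assms by simp
  qed
  ultimately show ?thesis by (auto simp: tasep_rate_def intro!: sum.neutral)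
qed

lemma tasep_rate_out:
  assumes "y \<in> tasep_states n"
  shows "(\<Sum>z\<in>tasep_states n. tasep_rate n \<alpha> \<beta> y z) =
    (\<Sum>i<n - 1. if y ! i = Occupied \<and> y ! Suc i = Empty then 1 else 0)
    + (if y ! 0 = Empty then \<alpha> else 0) + (if y ! (n - 1) = Occupied then \<beta> else 0)"
proof -
  have single: "(\<Sum>z\<in>tasep_states n. if P z then c else 0) = (if Q then c else 0)"
    if "\<And>z. P z \<longleftrightarrow> Q \<and> z = w" "w \<in> tasep_states n" for P Q w and c :: real
    using that by (cases Q) (simp_all add: finite_tasep_states)
  have "(\<Sum>z\<in>tasep_states n. tasep_rate n \<alpha> \<beta> y z) =
    (\<Sum>i<n - 1. \<Sum>z\<in>tasep_states n.
       if y ! i = Occupied \<and> y ! Suc i = Empty \<and> z = y[i := Empty, Suc i := Occupied] then 1 else 0)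
    + (\<Sum>z\<in>tasep_states n. if y ! 0 = Empty \<and> z = y[0 := Occupied] then \<alpha> else 0)
    + (\<Sum>z\<in>tasep_states n. if y ! (n - 1) = Occupied \<and> z = y[n - 1 := Empty] then \<beta> else 0)"
    unfolding tasep_rate_def sum.distrib by (subst sum.swap) (rule refl)
  also have "\<dots> =
    (\<Sum>i<n - 1. if y ! i = Occupied \<and> y ! Suc i = Empty then 1 else 0)
    + (if y ! 0 = Empty then \<alpha> else 0) + (if y ! (n - 1) = Occupied then \<beta> else 0)"
  proof (intro arg_cong2[where f = "(+)"] sum.cong refl)
    fix i
    show "(\<Sum>z\<in>tasep_states n. if y ! i = Occupied \<and> y ! Suc i = Empty \<and>
        z = y[i := Empty, Suc i := Occupied] then 1 else 0) =
        (if y ! i = Occupied \<and> y ! Suc i = Empty then 1 else 0 :: real)"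
      by (rule single[where w = "y[i := Empty, Suc i := Occupied]"])
        (use assms in \<open>auto simp: tasep_states_def\<close>)
  next
    show "(\<Sum>z\<in>tasep_states n. if y ! 0 = Empty \<and> z = y[0 := Occupied] then \<alpha> else 0) =
        (if y ! 0 = Empty then \<alpha> else 0)"
      by (rule single[where w = "y[0 := Occupied]"]) (use assms in \<open>auto simp: tasep_states_def\<close>)
  next
    show "(\<Sum>z\<in>tasep_states n. if y ! (n - 1) = Occupied \<and> z = y[n - 1 := Empty] then \<beta> else 0) =
        (if y ! (n - 1) = Occupied then \<beta> else 0)"
      by (rule single[where w = "y[n - 1 := Empty]"]) (use assms in \<open>auto simp: tasep_states_def\<close>)
  qed
  finally show ?thesis .
qed

lemma list_update_eq_iff:
  assumes "length x = length y" "i < length x"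
  shows "x ! i = a \<and> y = x[i := b] \<longleftrightarrow> y ! i = b \<and> x = y[i := a]"
  using assms by (metis list_update_id list_update_overwrite nth_list_update_eq)

lemma list_update2_eq_iff:
  assumes "length x = length y" "i < length x" "j < length x" "i \<noteq> j"
  shows "x ! i = a \<and> x ! j = b \<and> y = x[i := c, j := d] \<longleftrightarrow>
    (y ! i = c \<and> y ! j = d) \<and> x = y[i := a, j := b]"
proof -
  have "w ! i = p \<and> w ! j = q \<Longrightarrow> w[i := p', j := q', i := p, j := q] = w" for w :: "'a list" and p q p' q'
    using assms(4) by (metis list_update_id list_update_overwrite list_update_swap)
  then show ?thesis using assms by auto
qed

lemma tasep_rate_in:
  assumes "n \<ge> 1" "y \<in> tasep_states n"
  shows "(\<Sum>x\<in>tasep_states n. f x * tasep_rate n \<alpha> \<beta> x y) =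
    (\<Sum>i<n - 1. if y ! i = Empty \<and> y ! Suc i = Occupied
        then f (y[i := Occupied, Suc i := Empty]) else 0)
    + (if y ! 0 = Occupied then f (y[0 := Empty]) * \<alpha> else 0)
    + (if y ! (n - 1) = Empty then f (y[n - 1 := Occupied]) * \<beta> else 0)"
proof -
  have len: "length y = n" using assms by (simp add: tasep_states_def)
  have single: "(\<Sum>x\<in>tasep_states n. f x * (if P x then c else 0)) = (if Q then f w * c else 0)"
    if "\<And>x. length x = n \<Longrightarrow> P x \<longleftrightarrow> Q \<and> x = w" "length w = n" for P Q w and c :: real
  proof -
    have "(\<Sum>x\<in>tasep_states n. f x * (if P x then c else 0)) =
        (\<Sum>x\<in>tasep_states n. if x = w then (if Q then f w * c else 0) else 0)"
      by (rule sum.cong) (auto simp: that tasep_states_def)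
    moreover have "w \<in> tasep_states n" using that by (simp add: tasep_states_def)
    ultimately show ?thesis by (simp add: finite_tasep_states)
  qed
  have bond: "x ! i = Occupied \<and> x ! Suc i = Empty \<and> y = x[i := Empty, Suc i := Occupied] \<longleftrightarrow>
      (y ! i = Empty \<and> y ! Suc i = Occupied) \<and> x = y[i := Occupied, Suc i := Empty]"
    if "length x = n" "i < n - 1" for x i
    using list_update2_eq_iff[of x y i "Suc i"] that len by simp
  have left: "x ! 0 = Empty \<and> y = x[0 := Occupied] \<longleftrightarrow> y ! 0 = Occupied \<and> x = y[0 := Empty]"
    if "length x = n" for x
    using list_update_eq_iff[of x y 0] that len assms(1) by simp
  have right: "x ! (n - 1) = Occupied \<and> y = x[n - 1 := Empty] \<longleftrightarrow>
      y ! (n - 1) = Empty \<and> x = y[n - 1 := Occupied]"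
    if "length x = n" for x
    using list_update_eq_iff[of x y "n - 1"] that len assms(1) by simp
  have "(\<Sum>x\<in>tasep_states n. f x * tasep_rate n \<alpha> \<beta> x y) =
    (\<Sum>i<n - 1. \<Sum>x\<in>tasep_states n. f x *
       (if x ! i = Occupied \<and> x ! Suc i = Empty \<and> y = x[i := Empty, Suc i := Occupied] then 1 else 0))
    + (\<Sum>x\<in>tasep_states n. f x * (if x ! 0 = Empty \<and> y = x[0 := Occupied] then \<alpha> else 0))
    + (\<Sum>x\<in>tasep_states n. f x * (if x ! (n - 1) = Occupied \<and> y = x[n - 1 := Empty] then \<beta> else 0))"
    unfolding tasep_rate_def distrib_left sum.distrib sum_distrib_left
    by (subst sum.swap) (rule refl)
  also have "\<dots> = (\<Sum>i<n - 1. if y ! i = Empty \<and> y ! Suc i = Occupied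
        then f (y[i := Occupied, Suc i := Empty]) * 1 else 0)
    + (if y ! 0 = Occupied then f (y[0 := Empty]) * \<alpha> else 0)
    + (if y ! (n - 1) = Empty then f (y[n - 1 := Occupied]) * \<beta> else 0)"
  proof (intro arg_cong2[where f = "(+)"] sum.cong refl)
    fix i assume "i \<in> {..<n - 1}"
    then have "i < n - 1" by simp
    from single[OF bond[OF _ this]]
    show "(\<Sum>x\<in>tasep_states n. f x *
         (if x ! i = Occupied \<and> x ! Suc i = Empty \<and> y = x[i := Empty, Suc i := Occupied] then 1 else 0)) =
        (if y ! i = Empty \<and> y ! Suc i = Occupied
         then f (y[i := Occupied, Suc i := Empty]) * 1 else 0)"
      by (simp only: len length_list_update)
  next
    from single[OF left]
    show "(\<Sum>x\<in>tasep_states n. f x * (if x ! 0 = Empty \<and> y = x[0 := Occupied] then \<alpha> else 0)) =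
        (if y ! 0 = Occupied then f (y[0 := Empty]) * \<alpha> else 0)"
      by (simp only: len length_list_update)
  next
    from single[OF right]
    show "(\<Sum>x\<in>tasep_states n. f x *
         (if x ! (n - 1) = Occupied \<and> y = x[n - 1 := Empty] then \<beta> else 0)) =
        (if y ! (n - 1) = Empty then f (y[n - 1 := Occupied]) * \<beta> else 0)"
      by (simp only: len length_list_update)
  qed
  finally show ?thesis by (simp only: mult_1_right cong: if_cong)
qed

lemma canopy_weight_invariant:
  assumes n: "n \<ge> 1" and pos: "\<alpha> > 0" "\<beta> > 0"
  shows "invariant (tasep_states n) (tasep_rate n \<alpha> \<beta>) (canopy_weight \<alpha> \<beta>)"
  unfolding invariant_def
proof
  fix y assume y: "y \<in> tasep_states n"
  let ?S = "tasep_states n" and ?r = "tasep_rate n \<alpha> \<beta>" and ?F = "canopy_weight \<alpha> \<beta>"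
  define h where "h i = hole_sign (y ! i) * ?F (delete_nth i y)" for i
  have len: "length y = n" and "y \<noteq> []" using n y by (auto simp: tasep_states_def)
  have "(\<Sum>x\<in>?S. ?F x * generator ?S ?r x y) =
      (\<Sum>x\<in>?S. ?F x * ?r x y) - ?F y * (\<Sum>z\<in>?S. ?r y z)"
    using y n by (simp add: generator_column finite_tasep_states tasep_rate_self
        sum.remove[of ?S y "\<lambda>x. ?F x * ?r x y"] sum.remove[of ?S y "?r y"])
  also have "\<dots> = (\<Sum>i<n - 1. h i - h (Suc i)) - h 0 + h (n - 1)"
  proof -
    have "(\<Sum>i<n - 1. h i - h (Suc i)) =
        (\<Sum>i<n - 1. if y ! i = Empty \<and> y ! Suc i = Occupied
           then ?F (y[i := Occupied, Suc i := Empty]) else 0)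
        - ?F y * (\<Sum>i<n - 1. if y ! i = Occupied \<and> y ! Suc i = Empty then 1 else 0)"
      unfolding sum_distrib_left sum_subtractf[symmetric]
    proof (rule sum.cong)
      fix i assume "i \<in> {..<n - 1}"
      then have "Suc i < length y" using len by auto
      have mult_ite: "?F y * (if P then 1 else 0) = (if P then ?F y else 0)" for P by simp
      from bond_balance[OF \<open>Suc i < length y\<close>, of \<alpha> \<beta>]
      show "h i - h (Suc i) =
          (if y ! i = Empty \<and> y ! Suc i = Occupied
           then ?F (y[i := Occupied, Suc i := Empty]) else 0)
          - ?F y * (if y ! i = Occupied \<and> y ! Suc i = Empty then 1 else 0)"
        by (simp only: h_def mult_ite)
    qed simp
    moreover have "- h 0 = (if y ! 0 = Occupied then ?F (y[0 := Empty]) * \<alpha> else 0)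
        - ?F y * (if y ! 0 = Empty then \<alpha> else 0)"
      using left_balance[OF \<open>y \<noteq> []\<close> pos(1), of \<beta>] by (simp add: h_def split: if_splits)
    moreover have "h (n - 1) =
        (if y ! (n - 1) = Empty then ?F (y[n - 1 := Occupied]) * \<beta> else 0)
        - ?F y * (if y ! (n - 1) = Occupied then \<beta> else 0)"
      using right_balance[OF \<open>y \<noteq> []\<close> pos(2), of \<alpha>] by (simp add: h_def len split: if_splits)
    ultimately show ?thesis
      unfolding tasep_rate_in[OF n y] tasep_rate_out[OF y] by (simp only: distrib_left)
  qed
  also have "(\<Sum>i<n - 1. h i - h (Suc i)) = h 0 - h (n - 1)"
    by (rule sum_lessThan_telescope')
  finally show "(\<Sum>x\<in>?S. ?F x * generator ?S ?r x y) = 0" by simp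
qed


section \<open>The stationary distribution\<close>

text \<open>
  The number of jumps, exits included, that empty the strip when no further particle enters.
\<close>

definition exit_distance :: "nat \<Rightarrow> cell list \<Rightarrow> nat" where
  "exit_distance n u = (\<Sum>i<n. if u ! i = Occupied then n - i else 0)"

text \<open>
  The rightmost particle is never blocked: it can jump to the right, or leave from the last cell.
\<close>

lemma exit_distance_decreases:
  assumes n: "n \<ge> 1" and pos: "\<alpha> > 0" "\<beta> > 0" and u: "u \<in> tasep_states n"
    and ne: "u \<noteq> replicate n Empty"
  shows "\<exists>v\<in>tasep_states n. exit_distance n v < exit_distance n u \<and> tasep_rate n \<alpha> \<beta> u v > 0"
proof -
  have len: "length u = n" using u by (simp add: tasep_states_def)
  define P where "P i \<longleftrightarrow> i < n \<and> u ! i = Occupied" for i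
  have "\<exists>i. P i"
  proof (rule ccontr)
    assume "\<nexists>i. P i"
    then have "u ! i = Empty" if "i < n" for i using that by (cases "u ! i") (auto simp: P_def)
    then have "u = replicate n Empty" by (simp add: list_eq_iff_nth_eq len)
    then show False using ne by simp
  qed
  then obtain i where i: "P i" and max: "\<And>j. P j \<Longrightarrow> j \<le> i"
    using Nat.ex_has_greatest_nat[of P _ n] by (auto simp: P_def)
  have "i < n" and ui: "u ! i = Occupied" using i by (auto simp: P_def)
  show ?thesis
  proof (cases "Suc i = n")
    case True
    define v where "v = u[n - 1 := Empty]"
    have i_def: "i = n - 1" using True by simp
    have "v \<in> tasep_states n" using u by (simp add: v_def tasep_states_def)
    moreover have "exit_distance n v < exit_distance n u"
      unfolding exit_distance_def
    proof (rule sum_strict_mono_ex1)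
      show "\<forall>j\<in>{..<n}. (if v ! j = Occupied then n - j else 0) \<le> (if u ! j = Occupied then n - j else 0)"
        using len by (auto simp: v_def nth_list_update)
      show "\<exists>j\<in>{..<n}. (if v ! j = Occupied then n - j else 0) < (if u ! j = Occupied then n - j else 0)"
        using len \<open>i < n\<close> ui by (intro bexI[of _ i]) (auto simp: v_def i_def)
    qed simp
    moreover have "tasep_rate n \<alpha> \<beta> u v > 0"
      unfolding tasep_rate_def using pos ui i_def
      by (intro add_nonneg_pos add_nonneg_nonneg sum_nonneg) (auto simp: v_def)
    ultimately show ?thesis by blast
  next
    case False
    then have Si: "Suc i < n" using \<open>i < n\<close> by simp
    have uSi: "u ! Suc i = Empty"
      using max[of "Suc i"] Si by (cases "u ! Suc i") (auto simp: P_def)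
    define v where "v = u[i := Empty, Suc i := Occupied]"
    have "v \<in> tasep_states n" using u by (simp add: v_def tasep_states_def)
    moreover have "exit_distance n v < exit_distance n u"
    proof -
      have split: "exit_distance n w = (\<Sum>j\<in>{..<n} - {i, Suc i}. if w ! j = Occupied then n - j else 0)
          + ((if w ! i = Occupied then n - i else 0)
             + (if w ! Suc i = Occupied then n - Suc i else 0))" for w
        unfolding exit_distance_def
        using Si by (subst sum.subset_diff[of "{i, Suc i}"]) auto
      have "(\<Sum>j\<in>{..<n} - {i, Suc i}. if v ! j = Occupied then n - j else 0) =
          (\<Sum>j\<in>{..<n} - {i, Suc i}. if u ! j = Occupied then n - j else 0)"
        by (rule sum.cong) (auto simp: v_def)
      moreover have "v ! i = Empty" "v ! Suc i = Occupied"
        using len Si by (simp_all add: v_def)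
      ultimately show ?thesis
        using ui uSi Si by (simp add: split)
    qed
    moreover have "tasep_rate n \<alpha> \<beta> u v > 0"
    proof -
      have "(\<Sum>j<n - 1. if u ! j = Occupied \<and> u ! Suc j = Empty \<and>
          v = u[j := Empty, Suc j := Occupied] then 1 else 0) > (0 :: real)"
        using Si ui uSi by (intro sum_pos2[of _ i]) (auto simp: v_def)
      then show ?thesis
        unfolding tasep_rate_def using pos by (intro add_pos_nonneg) auto
    qed
    ultimately show ?thesis by blast
  qed
qed

lemma sum_canopy_weight:
  "(\<Sum>u\<in>tasep_states n. canopy_weight \<alpha> \<beta> u) = tree_Z n \<alpha> \<beta>"
proof -
  have "tree_Z n \<alpha> \<beta> = (\<Sum>u\<in>tasep_states n. \<Sum>t\<in>{t \<in> binary_trees (n + 1). butlast (occ t) = u}.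
      tree_weight \<alpha> \<beta> t)"
    unfolding tree_Z_def
    by (rule sum.group[symmetric, OF finite_binary_trees finite_tasep_states])
      (auto simp: binary_trees_def tasep_states_def)
  also have "\<dots> = (\<Sum>u\<in>tasep_states n. canopy_weight \<alpha> \<beta> u)"
    unfolding canopy_weight_def
  proof (intro sum.cong refl set_eqI)
    fix u and t :: "unit tree" assume "u \<in> tasep_states n"
    then show "t \<in> {t \<in> binary_trees (n + 1). butlast (occ t) = u} \<longleftrightarrow> t \<in> {t. occ t = u @ [Empty]}"
      using canopy_eq_iff[of t u]
      by (simp add: binary_trees_def tasep_states_def canopy_occ map_letter_of_eq_iff)
  qed
  finally show ?thesis ..
qed

lemma tree_Z_pos:
  assumes "\<alpha> > 0" "\<beta> > 0"
  shows "tree_Z n \<alpha> \<beta> > 0"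
proof -
  have "\<exists>t :: unit tree. size t = m" for m
  proof (induction m)
    case (Suc m)
    then show ?case by (metis size_graft)
  qed (use tree.size(3) in blast)
  then have "binary_trees (n + 1) \<noteq> {}" by (auto simp: binary_trees_def)
  then show ?thesis
    unfolding tree_Z_def by (intro sum_pos finite_binary_trees tree_weight_pos assms)
qed

theorem mainTheorem5:
  fixes n :: nat and \<alpha> \<beta> :: real and u :: "cell list"
  assumes "n \<ge> 1" and "\<alpha> > 0" and "\<beta> > 0"
    and "u \<in> tasep_states n"
  shows "tasep_prob n \<alpha> \<beta> u =
    1 / tree_Z n \<alpha> \<beta> *
      (\<Sum>B\<in>{B \<in> binary_trees (n + 1). canopy B = map letter_of u}. tree_weight \<alpha> \<beta> B)"
proof -
  let ?S = "tasep_states n" and ?r = "tasep_rate n \<alpha> \<beta>"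
  define f where "f x = (if x \<in> ?S then canopy_weight \<alpha> \<beta> x / tree_Z n \<alpha> \<beta> else 0)" for x
  have Z: "tree_Z n \<alpha> \<beta> > 0" by (rule tree_Z_pos) fact+
  have f_nonneg: "f x \<ge> 0" for x
    using Z assms(2,3) by (auto simp: f_def canopy_weight_def
        intro!: divide_nonneg_pos sum_nonneg less_imp_le[OF tree_weight_pos])
  have "(\<integral>\<^sup>+x. ennreal (f x) \<partial>count_space UNIV) = (\<Sum>x\<in>?S. ennreal (f x))"
    by (rule nn_integral_count_space') (auto simp: f_def finite_tasep_states)
  also have "\<dots> = ennreal (\<Sum>x\<in>?S. f x)"
    by (rule sum_ennreal) (rule f_nonneg)
  also have "(\<Sum>x\<in>?S. f x) = 1"
    using Z by (simp add: f_def sum_divide_distrib[symmetric] sum_canopy_weight)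
  finally have pmf_f: "pmf (embed_pmf f) x = f x" for x
    by (intro pmf_embed_pmf f_nonneg) simp
  have "stationary ?S ?r (embed_pmf f)"
    unfolding stationary_def
  proof (intro conjI ballI)
    show "set_pmf (embed_pmf f) \<subseteq> ?S"
      by (auto simp: set_pmf_iff pmf_f f_def split: if_splits)
    fix y assume y: "y \<in> ?S"
    have "(\<Sum>x\<in>?S. pmf (embed_pmf f) x * generator ?S ?r x y) =
        (\<Sum>x\<in>?S. canopy_weight \<alpha> \<beta> x * generator ?S ?r x y) / tree_Z n \<alpha> \<beta>"
      unfolding sum_divide_distrib by (rule sum.cong) (auto simp: pmf_f f_def)
    then show "(\<Sum>x\<in>?S. pmf (embed_pmf f) x * generator ?S ?r x y) = 0"
      using canopy_weight_invariant[OF assms(1-3)] y by (simp add: invariant_def)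
  qed
  moreover have "\<mu> = \<nu>" if "stationary ?S ?r \<mu>" "stationary ?S ?r \<nu>" for \<mu> \<nu>
    using stationary_unique[OF finite_tasep_states tasep_rate_nonneg[OF assms(2,3)]
        exit_distance_decreases[OF assms(1-3)] that] .
  ultimately have "tasep_dist n \<alpha> \<beta> = embed_pmf f"
    unfolding tasep_dist_def by (intro the_equality) auto
  moreover have "{B \<in> binary_trees (n + 1). canopy B = map letter_of u} = {t. occ t = u @ [Empty]}"
    using assms(4) canopy_eq_iff[of _ u] by (auto simp: binary_trees_def tasep_states_def)
  ultimately show ?thesis
    using assms(4) by (simp add: tasep_prob_def pmf_f f_def canopy_weight_def)
qed

end
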